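(* Let $I\subseteq K[x_1,\dots,x_n]$ be a zero-dimensional ideal, let $\Lambda(I)$ be the set of order ideals that are degree-compatible to $I$ and support a border basis of $I$, and let $P(I)\subseteq\mathbb{R}^{\mathbb{T}^n}$ be the order ideal polytope of $I$. Then the map $$\xi\colon P(I)\cap\mathbb{Z}^{\mathbb{T}^n}\to\Lambda(I),\qquad z\mapsto \mathcal{O}(z):=\{m\in\mathbb{T}^n\mid z_m=1\}$$ is a well-defined bijection between the set of integral points of $P(I)$ and $\Lambda(I)$.
   Context: $K$ is a field, $\mathbb{N}=\{0,1,2,\dots\}$, $\mathbb{T}^n$ is the set of monomials (terms) in $x_1,\dots,x_n$, and $\mathbb{T}^n_{=i}$ is the set of monomials of total degree $i$. $\langle S\rangle_K$ denotes the $K$-linear span of $S$. An ideal $I$ is zero-dimensional if $K[x_1,\dots,x_n]/I$ is a finite-dimensional $K$-vector space. An order ideal is a finite subset $\mathcal{O}\subseteq\mathbb{T}^n$ closed under taking divisors (the empty set is allowed). Put $\mathcal{O}^{=i}=\{m\in\mathcal{O}\mid\deg m=i\}$. The border of a non-empty order ideal is $\partial\mathcal{O}=\{x_jt\mid j\in\{1,\dots,n\},\,t\in\mathcal{O}\}\setminus\mathcal{O}$, and $\partial\emptyset=\{1\}$. For an order ideal $\mathcal{O}=\{t_1,\dots,t_\mu\}$ with border $\{b_1,\dots,b_\nu\}$, an $\mathcal{O}$-border basis of $I$ is a set $\{g_1,\dots,g_\nu\}$ of polynomials with $g_j=b_j-\sum_{i=1}^{\mu}\alpha_{ij}t_i$,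 $\alpha_{ij}\in K$, that generates $I$ as an ideal, where moreover $K[x_1,\dots,x_n]=I\oplus\langle\mathcal{O}\rangle_K$ as vector spaces. $\mathcal{O}$ supports a border basis of $I$ if an $\mathcal{O}$-border basis of $I$ exists (equivalently, $K[x_1,\dots,x_n]=I\oplus\langle\mathcal{O}\rangle_K$). Let $I^{\le i}=\{p\in I\mid \deg p\le i\}$ (including $0$), with $I^{\le -1}=0$. The quotient $I^{\le i}/I^{\le i-1}$ is identified with a subspace of $\langle\mathbb{T}^n_{=i}\rangle_K$ by sending the class of $p$ to its homogeneous component of degree $i$. An order ideal $\mathcal{O}$ is degree-compatible to $I$ if $\dim\langle\mathcal{O}^{=i}\rangle_K=\dim\langle\mathbb{T}^n_{=i}\rangle_K-\dim (I^{\le i}/I^{\le i-1})$ for all $i\in\mathbb{N}$. The order ideal polytope $P(I)$ is the set of all $z=(z_m)_{m\in\mathbb{T}^n}\in\mathbb{R}^{\mathbb{T}^n}$ satisfying: (1) $z_{m_1}\ge z_{m_2}$ for all $m_1,m_2\in\mathbb{T}^n$ with $m_1\mid m_2$; (2) $\sum_{m\in\mathbb{T}^n_{=i}}z_m=\dim\langle\mathbb{T}^n_{=i}\rangle_K-\dim(I^{\le i}/I^{\le i-1})$ for all $i\in\mathbb{N}$; (3) $\sum_{m\in U}z_m\le\dim\langle U\cup (I^{\le i}/I^{\le i-1})\rangle_K-\dim(I^{\le i}/I^{\le i-1})$ for all $i\in\mathbb{N}$ and all $U\subseteq\mathbb{T}^n_{=i}$ with $|U|=\dim\langle\mathbb{T}^n_{=i}\rangle_K-\dim(I^{\le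 i}/I^{\le i-1})$; (4) $z_m\in[0,1]$ for all $m\in\mathbb{T}^n$. *)

theory Defs
  imports Complex_Main "HOL-Library.Poly_Mapping" "HOL-Library.FuncSet"
begin

text \<open>
  The polynomial ring in finitely many indeterminates, indexed by a finite type \<open>'n\<close>: a monomial is
  its exponent vector, so the product of monomials is \<open>+\<close>, the monomial \<open>1\<close> is \<open>0\<close>, and the
  indeterminate \<open>x\<^sub>j\<close> is \<open>Poly_Mapping.single j 1\<close>.
\<close>

type_synonym 'n monomial = "'n \<Rightarrow>\<^sub>0 nat"
type_synonym ('n, 'k) mpoly = "'n monomial \<Rightarrow>\<^sub>0 'k"

text \<open>The order \<open>\<le>\<close> of the library on \<open>\<Rightarrow>\<^sub>0\<close> is lexicographic, hence not divisibility.\<close>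

definition mdvd :: "'n monomial \<Rightarrow> 'n monomial \<Rightarrow> bool" where
  "mdvd s t \<longleftrightarrow> (\<exists>u. t = s + u)"

definition mdeg :: "'n::finite monomial \<Rightarrow> nat" where
  "mdeg m = (\<Sum>j\<in>UNIV. Poly_Mapping.lookup m j)"

definition monomials_of_deg :: "nat \<Rightarrow> 'n::finite monomial set" where
  "monomials_of_deg i = {m. mdeg m = i}"

lemma finite_monomials_of_deg: "finite (monomials_of_deg i :: 'n::finite monomial set)"
proof (rule finite_subset)
  let ?F = "PiE UNIV (\<lambda>_. {..i}) :: ('n \<Rightarrow> nat) set"
  have "Poly_Mapping.lookup m \<in> ?F" if "mdeg m = i" for m :: "'n monomial"
    using that by (auto simp: mdeg_def PiE_UNIV_domain intro!: member_le_sum)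
  then show "(monomials_of_deg i :: 'n monomial set) \<subseteq> Poly_Mapping.lookup -` ?F"
    by (auto simp: monomials_of_deg_def)
  show "finite (Poly_Mapping.lookup -` ?F)"
    by (intro finite_vimageI finite_PiE) (auto simp: inj_def poly_mapping_eqI)
qed

definition monom :: "'n monomial \<Rightarrow> ('n, 'k::field) mpoly" where
  "monom m = Poly_Mapping.single m 1"

definition scale :: "'k::field \<Rightarrow> ('n, 'k) mpoly \<Rightarrow> ('n, 'k) mpoly" where
  "scale c p = Poly_Mapping.single 0 c * p"

global_interpretation mpoly: vector_space "scale :: 'k::field \<Rightarrow> ('n, 'k) mpoly \<Rightarrow> ('n, 'k) mpoly"
proof
  fix a b :: 'k and p q :: "('n, 'k) mpoly"
  show "scale a (p + q) = scale a p + scale a q"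
    by (simp add: scale_def distrib_left)
  show "scale (a + b) p = scale a p + scale b p"
    by (simp add: scale_def single_add distrib_right)
  show "scale a (scale b p) = scale (a * b) p"
    by (simp add: scale_def mult_single flip: mult.assoc)
  show "scale 1 p = p"
    by (simp add: scale_def)
qed

definition monomial_span :: "'n monomial set \<Rightarrow> ('n, 'k::field) mpoly set" where
  "monomial_span S = mpoly.span (monom ` S)"

definition is_ideal :: "('n, 'k::field) mpoly set \<Rightarrow> bool" where
  "is_ideal I \<longleftrightarrow> module.subspace (*) I"

definition ideal_generated :: "('n, 'k::field) mpoly set \<Rightarrow> ('n, 'k) mpoly set" where
  "ideal_generated G = module.span (*) G"

definition cong_rel :: "('n, 'k::field) mpoly set \<Rightarrow> (('n, 'k) mpoly \<times> ('n, 'k) mpoly) set" where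
  "cong_rel I = {(p, q). p - q \<in> I}"

text \<open>
  The quotient by \<open>I\<close> is spanned by the residue classes of finitely many polynomials; the linear
  combinations of these classes are the classes of the linear combinations.
\<close>

definition zero_dimensional :: "('n, 'k::field) mpoly set \<Rightarrow> bool" where
  "zero_dimensional I \<longleftrightarrow>
     (\<exists>B. finite B \<and> UNIV // cong_rel I = (\<lambda>p. cong_rel I `` {p}) ` mpoly.span B)"

definition order_ideal :: "'n monomial set \<Rightarrow> bool" where
  "order_ideal \<O> \<longleftrightarrow> finite \<O> \<and> (\<forall>t\<in>\<O>. \<forall>s. mdvd s t \<longrightarrow> s \<in> \<O>)"

definition border :: "'n monomial set \<Rightarrow> 'n monomial set" where
  "border \<O> = (if \<O> = {} then {0} else {Poly_Mapping.single j 1 + t | j t. t \<in> \<O>} - \<O>)"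

definition direct_sum_with :: "('n, 'k::field) mpoly set \<Rightarrow> 'n monomial set \<Rightarrow> bool" where
  "direct_sum_with I \<O> \<longleftrightarrow>
     {p + q | p q. p \<in> I \<and> q \<in> monomial_span \<O>} = UNIV \<and> I \<inter> monomial_span \<O> = {0}"

definition border_basis ::
    "'n monomial set \<Rightarrow> ('n, 'k::field) mpoly set \<Rightarrow> ('n, 'k) mpoly set \<Rightarrow> bool" where
  "border_basis \<O> I G \<longleftrightarrow>
     (\<exists>\<alpha>. G = (\<lambda>b. monom b - (\<Sum>t\<in>\<O>. scale (\<alpha> t b) (monom t))) ` border \<O>) \<and>
     ideal_generated G = I \<and> direct_sum_with I \<O>"

definition supports_border_basis :: "'n monomial set \<Rightarrow> ('n, 'k::field) mpoly set \<Rightarrow> bool" where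
  "supports_border_basis \<O> I \<longleftrightarrow> (\<exists>G. border_basis \<O> I G)"

definition hom_component :: "nat \<Rightarrow> ('n::finite, 'k::field) mpoly \<Rightarrow> ('n, 'k) mpoly" where
  "hom_component i p =
     (\<Sum>m\<in>Poly_Mapping.keys p \<inter> monomials_of_deg i. scale (Poly_Mapping.lookup p m) (monom m))"

text \<open>
  The degree bound is an integer so that \<open>ideal_le I (- 1)\<close> makes sense; it is \<open>{0}\<close>.
\<close>

definition ideal_le :: "('n::finite, 'k::field) mpoly set \<Rightarrow> int \<Rightarrow> ('n, 'k) mpoly set" where
  "ideal_le I d = {p \<in> I. \<forall>m\<in>Poly_Mapping.keys p. int (mdeg m) \<le> d}"

text \<open>
  The quotient of \<open>ideal_le I i\<close> by \<open>ideal_le I (i - 1)\<close>, identified with the space of the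
  homogeneous components of degree \<open>i\<close>; \<open>hom_component_eq_0_iff\<close> below says that the
  identification is injective.
\<close>

definition graded_piece :: "('n::finite, 'k::field) mpoly set \<Rightarrow> nat \<Rightarrow> ('n, 'k) mpoly set" where
  "graded_piece I i = hom_component i ` ideal_le I (int i)"

lemma lookup_hom_component:
  fixes p :: "('n::finite, 'k::field) mpoly"
  shows "Poly_Mapping.lookup (hom_component i p) m = (if mdeg m = i then Poly_Mapping.lookup p m else 0)"
proof -
  have sm: "scale c (monom m) = Poly_Mapping.single m c" for c :: 'k and m :: "'n monomial"
    by (simp add: scale_def monom_def mult_single)
  have "Poly_Mapping.lookup (hom_component i p) m =
      (\<Sum>t\<in>Poly_Mapping.keys p \<inter> monomials_of_deg i. if t = m then Poly_Mapping.lookup p m else 0)"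
    unfolding hom_component_def sm lookup_sum
    by (intro sum.cong) (auto simp: lookup_single when_def)
  then show ?thesis
    by (auto simp: sum.delta monomials_of_deg_def in_keys_iff)
qed

lemma hom_component_add: "hom_component i (p + q) = hom_component i p + hom_component i q"
  by (rule poly_mapping_eqI) (simp add: lookup_hom_component lookup_add)

lemma lookup_scale: "Poly_Mapping.lookup (scale c p) m = c * Poly_Mapping.lookup p m"
proof -
  have "scale c p = Poly_Mapping.map ((*) c) p"
    by (simp add: scale_def mult_map_scale_conv_mult)
  then show ?thesis
    by (simp add: Poly_Mapping.map.rep_eq when_def)
qed

lemma hom_component_scale: "hom_component i (scale c p) = scale c (hom_component i p)"
  by (rule poly_mapping_eqI) (simp add: lookup_hom_component lookup_scale)

lemma hom_component_eq_0_iff: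
  assumes "p \<in> ideal_le I (int i)"
  shows "hom_component i p = 0 \<longleftrightarrow> p \<in> ideal_le I (int i - 1)"
proof
  assume "hom_component i p = 0"
  then have "Poly_Mapping.lookup p m = 0" if "mdeg m = i" for m
    using that lookup_hom_component[of i p m] by simp
  then show "p \<in> ideal_le I (int i - 1)"
    using assms by (force simp: ideal_le_def in_keys_iff)
next
  assume "p \<in> ideal_le I (int i - 1)"
  then show "hom_component i p = 0"
    by (intro poly_mapping_eqI) (auto simp: lookup_hom_component ideal_le_def in_keys_iff)
qed

text \<open>An integer, since subtraction of natural numbers would truncate.\<close>

definition codim_graded_piece :: "('n::finite, 'k::field) mpoly set \<Rightarrow> nat \<Rightarrow> int" where
  "codim_graded_piece I i =
     int (mpoly.dim (monomial_span (monomials_of_deg i) :: ('n, 'k) mpoly set)) -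
     int (mpoly.dim (graded_piece I i))"

definition degree_compatible :: "'n::finite monomial set \<Rightarrow> ('n, 'k::field) mpoly set \<Rightarrow> bool" where
  "degree_compatible \<O> I \<longleftrightarrow>
     (\<forall>i. int (mpoly.dim (monomial_span {m \<in> \<O>. mdeg m = i} :: ('n, 'k) mpoly set)) =
          codim_graded_piece I i)"

definition Lambda :: "('n::finite, 'k::field) mpoly set \<Rightarrow> 'n monomial set set" where
  "Lambda I = {\<O>. order_ideal \<O> \<and> degree_compatible \<O> I \<and> supports_border_basis \<O> I}"

definition order_ideal_polytope ::
    "('n::finite, 'k::field) mpoly set \<Rightarrow> ('n monomial \<Rightarrow> real) set" where
  "order_ideal_polytope I = {z.
     (\<forall>m1 m2. mdvd m1 m2 \<longrightarrow> z m1 \<ge> z m2) \<and>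
     (\<forall>i. (\<Sum>m\<in>monomials_of_deg i. z m) = of_int (codim_graded_piece I i)) \<and>
     (\<forall>i. \<forall>U\<subseteq>monomials_of_deg i. int (card U) = codim_graded_piece I i \<longrightarrow>
        (\<Sum>m\<in>U. z m) \<le> real (mpoly.dim (mpoly.span (monom ` U \<union> graded_piece I i)))
                     - real (mpoly.dim (graded_piece I i))) \<and>
     (\<forall>m. z m \<in> {0..1})}"

end

theory Submission
  imports Defs
begin

text \<open>
  Let \<open>W\<^sub>i\<close> be the graded piece of \<open>I\<close> in degree \<open>i\<close> and \<open>d\<^sub>i\<close> its codimension. An order ideal \<open>\<O>\<close>
  lies in \<open>\<Lambda>(I)\<close> if and only if, for every \<open>i\<close>, it has \<open>d\<^sub>i\<close> monomials of degree \<open>i\<close> and their span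
  meets \<open>W\<^sub>i\<close> trivially: by descent on the degree this makes \<open>I\<close> and the span of \<open>\<O>\<close> complementary,
  and conversely.
  For a set \<open>U\<close> of monomials of degree \<open>i\<close>, the span of \<open>U\<close> meets \<open>W\<^sub>i\<close> trivially if and only if
  \<open>\<bar>U\<bar> \<le> dim \<langle>U \<union> W\<^sub>i\<rangle> - dim W\<^sub>i\<close>. An integral point of the polytope is the indicator function of a set
  \<open>\<O>\<close>, and the rank inequality for \<open>U = \<O>\<^bsup>=i\<^esup>\<close> is exactly this condition; the other rank inequalities
  follow from it. Since \<open>I\<close> is zero-dimensional, \<open>d\<^sub>i = 0\<close> for large \<open>i\<close>, so \<open>\<O>\<close> is finite.
\<close>

section \<open>Linear algebra\<close>

context vector_space
begin

text \<open>A vector in the span of the others could be dropped, leaving fewer than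
  \<open>dim S\<close> vectors that still span \<open>S\<close>.\<close>

lemma independent_if_card_le_dim:
  assumes "finite S" "card S \<le> dim S"
  shows "independent S"
proof
  assume "dependent S"
  then obtain a where a: "a \<in> S" "a \<in> span (S - {a})"
    by (auto simp: dependent_def)
  then have "S \<subseteq> span (S - {a})"
    by (auto intro: span_base)
  then have "dim S \<le> card (S - {a})"
    using assms(1) by (intro dim_le_card) auto
  also have "\<dots> < card S"
    using a assms(1) by (intro psubset_card_mono) auto
  finally show False
    using assms(2) by simp
qed

lemma independent_Un_disjoint_iff:
  assumes "finite U"
  shows "independent (U \<union> B) \<and> U \<inter> B = {} \<longleftrightarrow>
    independent U \<and> independent B \<and> span U \<inter> span B = {0}"
proof
  assume *: "independent (U \<union> B) \<and> U \<inter> B = {}"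
  \<comment> \<open>The coefficients of \<open>x\<close> over \<open>U \<union> B\<close> are
    supported in \<open>U\<close> and also in \<open>B\<close>; by disjointness they all
    vanish.\<close>
  have "x = 0" if x: "x \<in> span U" "x \<in> span B" for x
  proof -
    have "representation (U \<union> B) x = representation U x" "representation (U \<union> B) x = representation B x"
      using * x by (auto intro: representation_extend)
    then have "representation (U \<union> B) x b = 0" for b
      using * representation_ne_zero[of U x b] representation_ne_zero[of B x b] by auto
    moreover have "x \<in> span (U \<union> B)"
      using x span_mono[of U "U \<union> B"] by auto
    ultimately show "x = 0"
      using sum_nonzero_representation_eq[of "U \<union> B" x] * by simp
  qed
  then show "independent U \<and> independent B \<and> span U \<inter> span B = {0}"
    using * independent_mono[of "U \<union> B" U] independent_mono[of "U \<union> B" B] by (auto simp: span_zero)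
next
  assume "independent U \<and> independent B \<and> span U \<inter> span B = {0}"
  with assms show "independent (U \<union> B) \<and> U \<inter> B = {}"
  proof (induction U)
    case (insert u U)
    have U: "independent U" and u: "u \<notin> span U"
      using insert.prems insert.hyps by (auto simp: independent_insert)
    have "span U \<subseteq> span (insert u U)"
      by (rule span_mono) auto
    then have "span U \<inter> span B = {0}"
      using insert.prems span_zero[of U] span_zero[of B] by blast
    then have IH: "independent (U \<union> B)" "U \<inter> B = {}"
      using insert.IH insert.prems U by auto
    have "u \<notin> span (U \<union> B)"
    proof
      assume "u \<in> span (U \<union> B)"
      then obtain x y where xy: "x \<in> span U" "y \<in> span B" "u = x + y"
        by (auto simp: span_Un)
      have "u \<in> span (insert u U)" "x \<in> span (insert u U)"
        using xy \<open>span U \<subseteq> _\<close> by (auto intro: span_base)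
      \<comment> \<open>The vector \<open>u - x = y\<close> lies in both spans, hence is 0, which
        would put \<open>u = x\<close> into \<open>span U\<close>.\<close>
      then have "u - x \<in> span (insert u U)"
        by (rule span_diff)
      then have "y = 0"
        using xy insert.prems by auto
      then show False
        using xy u by simp
    qed
    moreover from this have "u \<notin> B"
      by (auto intro: span_base)
    ultimately show ?case
      using IH independent_insertI[of u "U \<union> B"] by simp
  qed auto
qed

text \<open>On an infinite-dimensional space \<open>dim\<close> is 0, because an infinite basis has
  \<open>card\<close> 0. The finite set \<open>T\<close> confines \<open>W\<close> to finite
  dimension, where \<open>dim W\<close> is the true dimension.\<close>

lemma finite_basis_exists:
  assumes "W \<subseteq> span T" "finite T"
  obtains B where "B \<subseteq> W" "independent B" "W \<subseteq> span B" "finite B" "card B = dim W"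
  by (metis assms basis_exists independent_span_bound order_trans)

text \<open>Together with a basis \<open>B\<close> of \<open>W\<close>, the set \<open>U\<close>
  generates the left-hand span. As \<open>card U + card B\<close> bounds its dimension from above,
  the inequality says that no generator is redundant or shared by \<open>U\<close> and
  \<open>B\<close>.\<close>

lemma dim_span_Un_subspace_ge_iff:
  assumes "finite U" "subspace W" "W \<subseteq> span T" "finite T"
  shows "card U + dim W \<le> dim (span (U \<union> W)) \<longleftrightarrow> independent U \<and> span U \<inter> W = {0}"
proof -
  obtain B where B: "B \<subseteq> W" "independent B" "W \<subseteq> span B" "finite B" "card B = dim W"
    using finite_basis_exists assms by metis
  have W: "span B = W"
    using B assms(2) by (intro span_subspace)
  have fin: "finite (U \<union> B)"
    using assms(1) B by auto
  have "span (U \<union> W) = span (U \<union> B)"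
    using W assms(2) by (simp add: span_Un del: span_eq_iff) (simp add: span_span flip: W)
  then have dim: "dim (span (U \<union> W)) = dim (U \<union> B)"
    by simp
  have "card U + card B \<le> dim (U \<union> B) \<longleftrightarrow> independent (U \<union> B) \<and> U \<inter> B = {}"
  proof
    assume le: "card U + card B \<le> dim (U \<union> B)"
    moreover have "dim (U \<union> B) \<le> card (U \<union> B)"
      using fin by (rule dim_le_card')
    moreover have "card U + card B = card (U \<union> B) + card (U \<inter> B)"
      using assms(1) B(4) by (rule card_Un_Int)
    ultimately have "card (U \<union> B) \<le> dim (U \<union> B)" "card (U \<inter> B) = 0"
      by linarith+
    then show "independent (U \<union> B) \<and> U \<inter> B = {}"
      using independent_if_card_le_dim[OF fin] assms(1) by simp
  next
    assume "independent (U \<union> B) \<and> U \<inter> B = {}"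
    then show "card U + card B \<le> dim (U \<union> B)"
      using assms(1) B(4) by (simp add: dim_eq_card_independent card_Un_disjoint)
  qed
  also have "\<dots> \<longleftrightarrow> independent U \<and> span U \<inter> W = {0}"
    using independent_Un_disjoint_iff[OF assms(1), of B] B W by simp
  finally show ?thesis
    using B dim by simp
qed

lemma dim_span_mono:
  assumes "A \<subseteq> B" "B \<subseteq> span T" "finite T"
  shows "dim (span A) \<le> dim (span B)"
proof -
  obtain C where "C \<subseteq> B" "independent C" "B \<subseteq> span C" "finite C" "card C = dim B"
    using finite_basis_exists assms by metis
  then show ?thesis
    using dim_le_card[of A C] assms(1) by auto
qed

text \<open>A vector of \<open>span T\<close> outside \<open>A\<close> would extend a basis of
  \<open>A\<close> to an independent set larger than \<open>dim (span T)\<close>.\<close>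

lemma subspace_eq_if_dim_ge:
  assumes "subspace A" "A \<subseteq> span T" "finite T" "dim (span T) \<le> dim A"
  shows "A = span T"
proof -
  obtain B where B: "B \<subseteq> A" "independent B" "A \<subseteq> span B" "finite B" "card B = dim A"
    using finite_basis_exists assms by metis
  obtain C where C: "C \<subseteq> span T" "independent C" "span T \<subseteq> span C" "finite C" "card C = dim (span T)"
    using finite_basis_exists[of "span T" T] assms(3) by auto
  have "v \<in> A" if "v \<in> span T" for v
  proof (rule ccontr)
    assume "v \<notin> A"
    then have v: "v \<notin> span B"
      using B assms(1) span_minimal by blast
    then have "independent (insert v B)"
      using B by (intro independent_insertI)
    moreover have "insert v B \<subseteq> span C"
      using that B assms(2) C by auto
    ultimately have "card (insert v B) \<le> card C"
      using independent_span_bound C by blast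
    moreover have "v \<notin> B"
      using v by (auto intro: span_base)
    ultimately show False
      using B C assms(4) by simp
  qed
  then show ?thesis
    using assms(2) by auto
qed

end

section \<open>Monomial spans and graded pieces\<close>

lemma lookup_monom: "Poly_Mapping.lookup (monom m) t = (if t = m then 1 else 0)"
  by (auto simp: monom_def lookup_single when_def)

lemma monom_mult: "monom s * monom t = monom (s + t)"
  by (simp add: monom_def mult_single)

lemma inj_monom: "inj monom"
  by (rule injI) (metis lookup_monom zero_neq_one)

lemma sum_monomials: "(\<Sum>t\<in>Poly_Mapping.keys p. scale (Poly_Mapping.lookup p t) (monom t)) = p"
  by (rule poly_mapping_eqI)
    (simp add: lookup_sum lookup_scale lookup_monom if_distrib sum.delta in_keys_iff cong: if_cong)

text \<open>Being supported in \<open>S\<close> is a linear condition satisfied by the monomials of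
  \<open>S\<close>; conversely a polynomial is the combination of its own terms.\<close>

lemma monomial_span_eq:
  "(monomial_span S :: ('n, 'k::field) mpoly set) = {p. Poly_Mapping.keys p \<subseteq> S}"
proof
  have "mpoly.subspace {p :: ('n, 'k) mpoly. Poly_Mapping.keys p \<subseteq> S}"
  proof (rule mpoly.subspaceI)
    fix x y :: "('n, 'k) mpoly"
    assume "x \<in> {p. Poly_Mapping.keys p \<subseteq> S}" "y \<in> {p. Poly_Mapping.keys p \<subseteq> S}"
    then show "x + y \<in> {p. Poly_Mapping.keys p \<subseteq> S}"
      using keys_add[of x y] by auto
  qed (auto simp: in_keys_iff lookup_scale)
  moreover have "monom ` S \<subseteq> {p :: ('n, 'k) mpoly. Poly_Mapping.keys p \<subseteq> S}"
    by (auto simp: monom_def)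
  ultimately show "monomial_span S \<subseteq> {p :: ('n, 'k) mpoly. Poly_Mapping.keys p \<subseteq> S}"
    unfolding monomial_span_def by (intro mpoly.span_minimal)
next
  show "{p :: ('n, 'k) mpoly. Poly_Mapping.keys p \<subseteq> S} \<subseteq> monomial_span S"
  proof safe
    fix p :: "('n, 'k) mpoly"
    assume "Poly_Mapping.keys p \<subseteq> S"
    then have "(\<Sum>t\<in>Poly_Mapping.keys p. scale (Poly_Mapping.lookup p t) (monom t)) \<in> monomial_span S"
      unfolding monomial_span_def
      by (intro mpoly.span_sum mpoly.span_scale mpoly.span_base) auto
    then show "p \<in> monomial_span S"
      by (simp add: sum_monomials)
  qed
qed

lemma independent_monoms:
  fixes S :: "'n monomial set"
  shows "mpoly.independent (monom ` S :: ('n, 'k::field) mpoly set)"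
proof
  assume "mpoly.dependent (monom ` S :: ('n, 'k) mpoly set)"
  then obtain m where "m \<in> S" "(monom m :: ('n, 'k) mpoly) \<in> mpoly.span (monom ` S - {monom m})"
    by (auto simp: mpoly.dependent_def)
  moreover have "monom ` S - {monom m} = (monom ` (S - {m}) :: ('n, 'k) mpoly set)"
    by (auto simp: inj_eq[OF inj_monom])
  ultimately have "monom m \<in> (monomial_span (S - {m}) :: ('n, 'k) mpoly set)"
    by (simp add: monomial_span_def)
  then show False
    by (auto simp: monomial_span_eq monom_def)
qed

lemma card_monoms [simp]: "card (monom ` S) = card S"
  by (intro card_image inj_on_subset[OF inj_monom]) auto

lemma dim_monomial_span: "mpoly.dim (monomial_span S) = card S"
  unfolding monomial_span_def
  by (simp add: mpoly.dim_span_eq_card_independent independent_monoms del: mpoly.dim_span)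

text \<open>An ideal is a submodule of the ring over itself, so this gives access to the general
  facts on submodules and their spans for \<open>is_ideal\<close> and
  \<open>ideal_generated\<close>.\<close>

lemma module_mult: "module ((*) :: 'a::comm_ring_1 \<Rightarrow> 'a \<Rightarrow> 'a)"
  by unfold_locales (simp_all add: algebra_simps)

lemma is_ideal_subspace: "is_ideal I \<Longrightarrow> mpoly.subspace I"
  unfolding is_ideal_def
  by (intro mpoly.subspaceI)
    (auto simp: scale_def module.subspace_0[OF module_mult] module.subspace_add[OF module_mult] module.subspace_scale[OF module_mult])

lemma subspace_graded_piece:
  assumes "is_ideal I"
  shows "mpoly.subspace (graded_piece I i)"
proof (rule mpoly.subspaceI)
  note I = is_ideal_subspace[OF assms]
  have "0 \<in> ideal_le I (int i)"
    using I by (simp add: ideal_le_def mpoly.subspace_0)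
  moreover have "hom_component i 0 = 0"
    by (rule poly_mapping_eqI) (simp add: lookup_hom_component)
  ultimately show "0 \<in> graded_piece I i"
    unfolding graded_piece_def by (metis image_eqI)
next
  fix x y assume "x \<in> graded_piece I i" "y \<in> graded_piece I i"
  then obtain p q where "p \<in> ideal_le I (int i)" "q \<in> ideal_le I (int i)"
    and xy: "x = hom_component i p" "y = hom_component i q"
    by (auto simp: graded_piece_def)
  then have "p + q \<in> ideal_le I (int i)"
    using is_ideal_subspace[OF assms] keys_add[of p q]
    by (auto simp: ideal_le_def mpoly.subspace_add)
  then show "x + y \<in> graded_piece I i"
    by (auto simp: graded_piece_def xy hom_component_add[symmetric])
next
  fix c x assume "x \<in> graded_piece I i"
  then obtain p where "p \<in> ideal_le I (int i)" and x: "x = hom_component i p"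
    by (auto simp: graded_piece_def)
  then have "scale c p \<in> ideal_le I (int i)"
    using is_ideal_subspace[OF assms]
    by (auto simp: ideal_le_def mpoly.subspace_scale in_keys_iff lookup_scale)
  then show "scale c x \<in> graded_piece I i"
    by (auto simp: graded_piece_def x hom_component_scale[symmetric])
qed

lemma graded_piece_subset: "graded_piece I i \<subseteq> monomial_span (monomials_of_deg i)"
  by (auto simp: graded_piece_def monomial_span_eq monomials_of_deg_def in_keys_iff
      lookup_hom_component split: if_splits)

lemma codim_graded_piece_eq:
  fixes I :: "('n::finite, 'k::field) mpoly set"
  shows "codim_graded_piece I i =
    int (card (monomials_of_deg i :: 'n monomial set)) - int (mpoly.dim (graded_piece I i))"
  by (simp add: codim_graded_piece_def dim_monomial_span)

text \<open>Monomials are independent, so only the intersection condition of the general criterion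
  remains. This is how the rank inequalities of the polytope are read.\<close>

lemma dim_span_monoms_graded_piece_ge_iff:
  fixes I :: "('n::finite, 'k::field) mpoly set"
  assumes "is_ideal I" "finite U"
  shows "card U + mpoly.dim (graded_piece I i) \<le> mpoly.dim (mpoly.span (monom ` U \<union> graded_piece I i))
    \<longleftrightarrow> monomial_span U \<inter> graded_piece I i = {0}"
proof -
  have "mpoly.independent (monom ` U :: ('n, 'k) mpoly set)"
    by (rule independent_monoms)
  moreover have "graded_piece I i \<subseteq> mpoly.span (monom ` monomials_of_deg i)"
    using graded_piece_subset[of I i] by (simp add: monomial_span_def)
  ultimately show ?thesis
    using mpoly.dim_span_Un_subspace_ge_iff[of "monom ` U" "graded_piece I i" "monom ` monomials_of_deg i"]
      assms subspace_graded_piece[OF assms(1)]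
    by (simp add: finite_monomials_of_deg monomial_span_def del: mpoly.dim_span)
qed

text \<open>By trivial intersection the sum of the two spaces has dimension at least
  \<open>card U + dim (graded_piece I i)\<close>, which is the number of monomials of degree
  \<open>i\<close>; so it is the whole homogeneous space.\<close>

lemma monomials_of_deg_decomposition:
  fixes I :: "('n::finite, 'k::field) mpoly set"
  assumes I: "is_ideal I" and U: "U \<subseteq> monomials_of_deg i" "int (card U) = codim_graded_piece I i"
    and trivial: "monomial_span U \<inter> graded_piece I i = {0}"
    and p: "p \<in> monomial_span (monomials_of_deg i)"
  obtains w q where "w \<in> graded_piece I i" "q \<in> monomial_span U" "p = q + w"
proof -
  let ?A = "mpoly.span (monom ` U \<union> graded_piece I i)"
  have "card U + mpoly.dim (graded_piece I i) \<le> mpoly.dim ?A"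
    using dim_span_monoms_graded_piece_ge_iff[OF I] U(1) finite_subset[OF _ finite_monomials_of_deg]
      trivial by blast
  moreover have "mpoly.dim (mpoly.span (monom ` monomials_of_deg i) :: ('n, 'k) mpoly set)
      = card (monomials_of_deg i :: 'n monomial set)"
    using dim_monomial_span[of "monomials_of_deg i"] by (simp only: monomial_span_def)
  moreover have "?A \<subseteq> mpoly.span (monom ` monomials_of_deg i)"
    using U(1) graded_piece_subset[of I i]
    by (intro mpoly.span_minimal) (auto simp: monomial_span_def intro: mpoly.span_base)
  ultimately have "?A = mpoly.span (monom ` monomials_of_deg i)"
    using U(2) by (intro mpoly.subspace_eq_if_dim_ge)
      (auto simp: codim_graded_piece_eq finite_monomials_of_deg)
  then have "p \<in> ?A"
    using p by (simp add: monomial_span_def)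
  then obtain q w where "q \<in> mpoly.span (monom ` U)" "w \<in> mpoly.span (graded_piece I i)" "p = q + w"
    by (auto simp: mpoly.span_Un)
  moreover have "mpoly.span (graded_piece I i) = graded_piece I i"
    using subspace_graded_piece[OF I] by simp
  ultimately show ?thesis
    using that by (auto simp: monomial_span_def)
qed

section \<open>Comparing the direct sum with its graded pieces\<close>

text \<open>The top form of \<open>p\<close> is cancelled by an element of \<open>I\<close> and one
  of the span of \<O>, and the remainder has smaller degree. Only degrees below \<open>i\<close> are
  assumed, so that an induction on \<open>i\<close> can use the result before degree
  \<open>i\<close> is settled.\<close>

lemma low_degree_decomposition:
  fixes I :: "('n::finite, 'k::field) mpoly set"
  assumes I: "is_ideal I"
    and card: "\<And>j. j < i \<Longrightarrow> int (card {m \<in> \<O>. mdeg m = j}) = codim_graded_piece I j"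
    and trivial: "\<And>j. j < i \<Longrightarrow> monomial_span {m \<in> \<O>. mdeg m = j} \<inter> graded_piece I j = {0}"
    and p: "\<forall>m\<in>Poly_Mapping.keys p. mdeg m < i"
  shows "\<exists>r\<in>I. \<exists>q\<in>monomial_span \<O>. (\<forall>m\<in>Poly_Mapping.keys q. mdeg m < i) \<and> p = r + q"
  using assms
proof (induction i arbitrary: p)
  case 0
  then have "p = 0"
    by (auto intro!: poly_mapping_eqI simp: in_keys_iff)
  then show ?case
    using is_ideal_subspace[OF I]
    by (auto intro!: bexI[of _ 0] simp: monomial_span_eq mpoly.subspace_0)
next
  case (Suc i)
  let ?U = "{m \<in> \<O>. mdeg m = i}"
  have hp: "hom_component i p \<in> monomial_span (monomials_of_deg i)"
    by (auto simp: monomial_span_eq monomials_of_deg_def in_keys_iff lookup_hom_component split: if_splits)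
  obtain w q where w: "w \<in> graded_piece I i" and q: "q \<in> monomial_span ?U"
    and eq: "hom_component i p = q + w"
    by (rule monomials_of_deg_decomposition[of I ?U i "hom_component i p"])
      (use Suc.prems hp in \<open>auto simp: monomials_of_deg_def\<close>)
  obtain r where r: "r \<in> ideal_le I (int i)" "w = hom_component i r"
    using w by (auto simp: graded_piece_def)
  have "\<forall>m\<in>Poly_Mapping.keys (p - r - q). mdeg m < i"
  proof
    fix m assume m: "m \<in> Poly_Mapping.keys (p - r - q)"
    \<comment> \<open>In degree \<open>i\<close>, the part of \<open>p\<close> is
      \<open>q + w\<close>, and \<open>w\<close> is the part of \<open>r\<close>.\<close>
    have "Poly_Mapping.lookup (p - r - q) m = 0" if "mdeg m = i"
      using arg_cong[OF eq, of "\<lambda>p. Poly_Mapping.lookup p m"] that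
      by (simp add: r lookup_hom_component lookup_add lookup_minus)
    then have "mdeg m \<noteq> i"
      using m by (auto simp: in_keys_iff)
    moreover have "m \<in> Poly_Mapping.keys p \<or> m \<in> Poly_Mapping.keys r \<or> m \<in> Poly_Mapping.keys q"
      using m by (auto simp: in_keys_iff lookup_minus)
    then have "mdeg m \<le> i"
      using Suc.prems(4) r q by (auto simp: ideal_le_def monomial_span_eq)
    ultimately show "mdeg m < i"
      by simp
  qed
  from Suc.IH[OF I _ _ this] Suc.prems(2,3) obtain r' q' where r': "r' \<in> I" "q' \<in> monomial_span \<O>"
    "\<forall>m\<in>Poly_Mapping.keys q'. mdeg m < i" "p - r - q = r' + q'"
    by auto
  have "r + r' \<in> I"
    using r r' is_ideal_subspace[OF I] by (auto simp: ideal_le_def mpoly.subspace_add)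
  moreover have "q + q' \<in> monomial_span \<O>" "\<forall>m\<in>Poly_Mapping.keys (q + q'). mdeg m < Suc i"
    using q r' keys_add[of q q'] by (fastforce simp: monomial_span_eq)+
  moreover have "p = (r + r') + (q + q')"
    using r'(4) by (simp add: algebra_simps)
  ultimately show ?case
    by blast
qed

text \<open>Stripping top forms gives the sum. For the intersection, the top form of a nonzero
  common element would lie both in a graded piece and in the span of a degree slice of \<O>.\<close>

lemma direct_sum_with_if_graded:
  fixes I :: "('n::finite, 'k::field) mpoly set"
  assumes I: "is_ideal I"
    and card: "\<And>i. int (card {m \<in> \<O>. mdeg m = i}) = codim_graded_piece I i"
    and trivial: "\<And>i. monomial_span {m \<in> \<O>. mdeg m = i} \<inter> graded_piece I i = {0}"
  shows "direct_sum_with I \<O>"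
  unfolding direct_sum_with_def
proof
  have "\<exists>r\<in>I. \<exists>q\<in>monomial_span \<O>. p = r + q" for p
  proof -
    \<comment> \<open>For \<open>p = 0\<close> the maximum ranges over the empty set and is
      unspecified, but the claim is then vacuous.\<close>
    have "\<forall>m\<in>Poly_Mapping.keys p. mdeg m < Suc (Max (mdeg ` Poly_Mapping.keys p))"
      by (auto simp: less_Suc_eq_le)
    then show ?thesis
      using low_degree_decomposition[OF I card trivial] by metis
  qed
  then show "{p + q |p q. p \<in> I \<and> q \<in> monomial_span \<O>} = UNIV"
    by blast
next
  have "p = 0" if p: "p \<in> I" "p \<in> monomial_span \<O>" for p
  proof (rule ccontr)
    assume "p \<noteq> 0"
    then have ne: "Poly_Mapping.keys p \<noteq> {}"
      by (metis in_keys_iff empty_iff lookup_zero poly_mapping_eqI)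
    define i where "i = Max (mdeg ` Poly_Mapping.keys p)"
    obtain m where m: "m \<in> Poly_Mapping.keys p" "mdeg m = i"
      using Max_in[of "mdeg ` Poly_Mapping.keys p"] ne unfolding i_def by fastforce
    have "p \<in> ideal_le I (int i)"
      using p by (auto simp: ideal_le_def i_def)
    then have "hom_component i p \<in> graded_piece I i"
      by (auto simp: graded_piece_def)
    moreover have "hom_component i p \<in> monomial_span {m \<in> \<O>. mdeg m = i}"
      using p by (auto simp: monomial_span_eq in_keys_iff lookup_hom_component split: if_splits)
    ultimately have "hom_component i p = 0"
      using trivial[of i] by blast
    then show False
      using m lookup_hom_component[of i p m] by (simp add: in_keys_iff)
  qed
  moreover have "0 \<in> I"
    using is_ideal_subspace[OF I] by (rule mpoly.subspace_0)
  ultimately show "I \<inter> monomial_span \<O> = {0}"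
    by (auto simp: monomial_span_eq)
qed

text \<open>
  Given the decomposition in degrees below \<open>i\<close>, an element \<open>w\<close> of the intersection in degree \<open>i\<close> is the
  leading form of some \<open>p \<in> I\<close>; reducing \<open>p - w\<close> modulo \<open>I\<close> to the span of \<open>\<O>\<close> yields an element of
  \<open>I\<close> in that span with leading form \<open>w\<close>.
\<close>

lemma direct_sum_with_imp_graded_trivial:
  fixes I :: "('n::finite, 'k::field) mpoly set"
  assumes I: "is_ideal I"
    and card: "\<And>i. int (card {m \<in> \<O>. mdeg m = i}) = codim_graded_piece I i"
    and sum: "direct_sum_with I \<O>"
  shows "monomial_span {m \<in> \<O>. mdeg m = i} \<inter> graded_piece I i = {0}"
proof (induction i rule: less_induct)
  case (less i)
  have "w = 0" if w: "w \<in> monomial_span {m \<in> \<O>. mdeg m = i}" "w \<in> graded_piece I i" for w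
  proof -
    obtain p where p: "p \<in> ideal_le I (int i)" "w = hom_component i p"
      using w by (auto simp: graded_piece_def)
    have "\<forall>m\<in>Poly_Mapping.keys (p - w). mdeg m < i"
      using p by (force simp: in_keys_iff lookup_minus lookup_hom_component ideal_le_def split: if_splits)
    then obtain r q where r: "r \<in> I" "q \<in> monomial_span \<O>"
      "\<forall>m\<in>Poly_Mapping.keys q. mdeg m < i" "p - w = r + q"
      using low_degree_decomposition[OF I card less] by metis
    have eq: "p - r = w + q"
      using r(4) by (simp add: algebra_simps)
    have "w + q \<in> monomial_span \<O>"
      using w r keys_add[of w q] by (auto simp: monomial_span_eq)
    moreover have "p - r \<in> I"
      using p r is_ideal_subspace[OF I] by (auto simp: ideal_le_def mpoly.subspace_diff)
    ultimately have "w + q = 0"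
      using sum eq by (auto simp: direct_sum_with_def)
    show "w = 0"
    proof (rule poly_mapping_eqI)
      fix m
      have "Poly_Mapping.lookup q m = 0" if "mdeg m = i"
        using r(3) that by (auto simp: in_keys_iff)
      then show "Poly_Mapping.lookup w m = Poly_Mapping.lookup 0 m"
        using arg_cong[OF \<open>w + q = 0\<close>, of "\<lambda>p. Poly_Mapping.lookup p m"]
        by (cases "mdeg m = i") (auto simp: lookup_add p(2) lookup_hom_component)
    qed
  qed
  moreover have "0 \<in> graded_piece I i"
    using subspace_graded_piece[OF I] by (rule mpoly.subspace_0)
  ultimately show ?case
    by (auto simp: monomial_span_eq)
qed

text \<open>Each monomial is congruent modulo \<open>I\<close> to a combination of finitely many
  polynomials, of degree at most \<open>D\<close>. A monomial of degree above \<open>D\<close> is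
  thus itself the top form of an element of \<open>I\<close>.\<close>

lemma zero_dimensional_codim_eventually_0:
  fixes I :: "('n::finite, 'k::field) mpoly set"
  assumes I: "is_ideal I" and "zero_dimensional I"
  obtains D where "\<And>i. i > D \<Longrightarrow> codim_graded_piece I i = 0"
proof -
  obtain B where B: "finite B" "UNIV // cong_rel I = (\<lambda>p. cong_rel I `` {p}) ` mpoly.span B"
    using assms(2) by (auto simp: zero_dimensional_def)
  \<comment> \<open>If \<open>B\<close> contains no nonzero polynomial, this is an unspecified
    number, and any bound will do.\<close>
  define D where "D = Max (mdeg ` (\<Union>b\<in>B. Poly_Mapping.keys b))"
  have "B \<subseteq> monomial_span {m. mdeg m \<le> D}"
    using B(1) by (auto simp: monomial_span_eq D_def intro!: Max_ge)
  then have span_B: "mpoly.span B \<subseteq> monomial_span {m. mdeg m \<le> D}"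
    unfolding monomial_span_def by (intro mpoly.span_minimal) auto
  have "codim_graded_piece I i = 0" if "i > D" for i
  proof -
    have "monom m \<in> graded_piece I i" if m: "m \<in> monomials_of_deg i" for m :: "'n monomial"
    proof -
      have "cong_rel I `` {monom m} \<in> UNIV // cong_rel I"
        by (rule quotientI) simp
      then obtain q where q: "q \<in> mpoly.span B" "cong_rel I `` {monom m} = cong_rel I `` {q}"
        using B(2) by auto
      have "q \<in> cong_rel I `` {q}"
        using is_ideal_subspace[OF I] by (simp add: cong_rel_def mpoly.subspace_0)
      then have "(monom m, q) \<in> cong_rel I"
        using q(2) by blast
      then have mem: "monom m - q \<in> I"
        by (simp add: cong_rel_def)
      have qD: "mdeg t \<le> D" if "t \<in> Poly_Mapping.keys q" for t
        using that q(1) span_B by (auto simp: monomial_span_eq)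
      have "t \<in> Poly_Mapping.keys (monom m - q) \<Longrightarrow> mdeg t \<le> i" for t
        using qD[of t] m \<open>i > D\<close>
        by (cases "t = m") (auto simp: in_keys_iff lookup_minus lookup_monom monomials_of_deg_def)
      then have "monom m - q \<in> ideal_le I (int i)"
        using mem by (auto simp: ideal_le_def)
      moreover have "Poly_Mapping.lookup q t = 0" if "mdeg t = i" for t
        using qD[of t] that \<open>i > D\<close> by (auto simp: in_keys_iff)
      then have "hom_component i (monom m - q) = monom m"
        using m by (intro poly_mapping_eqI)
          (auto simp: lookup_hom_component lookup_minus lookup_monom monomials_of_deg_def)
      ultimately show ?thesis
        unfolding graded_piece_def by (metis image_eqI)
    qed
    then have "monomial_span (monomials_of_deg i) \<subseteq> graded_piece I i"
      unfolding monomial_span_def using subspace_graded_piece[OF I] by (intro mpoly.span_minimal) auto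
    then have "graded_piece I i = monomial_span (monomials_of_deg i)"
      using graded_piece_subset by blast
    then show ?thesis
      by (simp add: codim_graded_piece_def)
  qed
  then show ?thesis
    using that by blast
qed

section \<open>Existence of border bases\<close>

lemma monomial_induct:
  fixes m :: "'n::finite monomial"
  assumes "P 0" "\<And>j m. P m \<Longrightarrow> P (Poly_Mapping.single j 1 + m)"
  shows "P m"
proof (induction "mdeg m" arbitrary: m)
  case 0
  then have "m = 0"
    by (intro poly_mapping_eqI) (simp add: mdeg_def)
  then show ?case
    using assms(1) by simp
next
  case (Suc d)
  have "mdeg m \<noteq> 0"
    using Suc by simp
  then obtain j where j: "Poly_Mapping.lookup m j \<noteq> 0"
    unfolding mdeg_def by (rule sum.not_neutral_contains_not_neutral)
  define m' where "m' = m - Poly_Mapping.single j 1"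
  \<comment> \<open>The subtraction of exponents does not truncate, as \<open_j_placeholder>\<close>
  have m: "m = Poly_Mapping.single j 1 + m'"
    using j by (intro poly_mapping_eqI) (auto simp: m'_def lookup_add lookup_minus lookup_single when_def)
  have "mdeg m = Suc (mdeg m')"
    by (simp add: m mdeg_def lookup_add sum.distrib lookup_single when_def)
  then have "P m'"
    using Suc by simp
  then show ?case
    using assms(2) m by metis
qed

text \<open>
  The ideal \<open>J\<close> generated by the border prebasis satisfies \<open>J + \<langle>\<O>\<rangle> = UNIV\<close>, because that sum
  contains \<open>1\<close> and is closed under multiplication by the indeterminates.
\<close>

lemma supports_border_basis_if_direct_sum:
  fixes I :: "('n::finite, 'k::field) mpoly set"
  assumes I: "is_ideal I" and \<O>: "order_ideal \<O>" and sum: "direct_sum_with I \<O>"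
  shows "supports_border_basis \<O> I"
proof -
  have "\<exists>q\<in>monomial_span \<O>. monom b - q \<in> I" for b
  proof -
    have "monom b \<in> {p + q |p q. p \<in> I \<and> q \<in> monomial_span \<O>}"
      using sum by (auto simp: direct_sum_with_def)
    then show ?thesis
      by force
  qed
  then obtain q where q: "\<And>b. q b \<in> monomial_span \<O>" "\<And>b. monom b - q b \<in> I"
    by metis
  define G where "G = (\<lambda>b. monom b - q b) ` border \<O>"
  define J where "J = ideal_generated G"
  define M where "M = {p + r |p r. p \<in> J \<and> r \<in> monomial_span \<O>}"
  have q_sum: "q b = (\<Sum>t\<in>\<O>. scale (Poly_Mapping.lookup (q b) t) (monom t))" for b
  proof -
    have "(\<Sum>t\<in>\<O>. scale (Poly_Mapping.lookup (q b) t) (monom t)) =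
        (\<Sum>t\<in>Poly_Mapping.keys (q b). scale (Poly_Mapping.lookup (q b) t) (monom t))"
      using q(1)[of b] \<O> by (intro sum.mono_neutral_right)
        (auto simp: order_ideal_def monomial_span_eq in_keys_iff)
    then show ?thesis
      by (simp add: sum_monomials)
  qed
  have "J \<subseteq> I"
    using I q unfolding J_def ideal_generated_def is_ideal_def
    by (intro module.span_minimal[OF module_mult]) (auto simp: G_def)
  have J: "is_ideal J"
    by (simp add: J_def is_ideal_def ideal_generated_def module.subspace_span[OF module_mult])
  have M: "mpoly.subspace M"
    unfolding M_def using is_ideal_subspace[OF J]
    by (intro mpoly.subspace_sums) (auto simp: monomial_span_def)
  have J_M: "J \<subseteq> M"
    unfolding M_def by (force simp: monomial_span_eq)
  have span_M: "monomial_span \<O> \<subseteq> M"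
    unfolding M_def using mpoly.subspace_0[OF is_ideal_subspace[OF J]] by force
  have border_M: "monom b \<in> M" if "b \<in> border \<O>" for b
  proof -
    have "monom b - q b \<in> J"
      unfolding J_def ideal_generated_def by (rule module.span_base[OF module_mult]) (use that in \<open>auto simp: G_def\<close>)
    then show ?thesis
      unfolding M_def using q(1)[of b] by force
  qed
  have one: "monom 0 \<in> M"
  proof (cases "\<O> = {}")
    case True
    then show ?thesis
      by (intro border_M) (simp add: border_def)
  next
    case False
    then have "0 \<in> \<O>"
      using \<O> by (auto simp: order_ideal_def mdvd_def)
    then have "monom 0 \<in> monomial_span \<O>"
      by (auto simp: monomial_span_def intro: mpoly.span_base)
    then show ?thesis
      using span_M by blast
  qed
  have shift: "monom (Poly_Mapping.single j 1) * p \<in> M" if p: "p \<in> M" for j p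
  proof -
    let ?x = "monom (Poly_Mapping.single j 1) :: ('n, 'k) mpoly"
    obtain g r where g: "g \<in> J" "r \<in> monomial_span \<O>" "p = g + r"
      using p unfolding M_def by blast
    have "?x * g \<in> M"
      using J J_M g(1) unfolding is_ideal_def by (auto simp: module.subspace_scale[OF module_mult])
    moreover have "?x * r \<in> M"
      using g(2) unfolding monomial_span_def
    proof (induction rule: mpoly.span_induct)
      case base
      show ?case
        using M mpoly.subspace_scale[OF M]
        by (intro mpoly.subspaceI)
          (auto simp: distrib_left mpoly.subspace_0 mpoly.subspace_add scale_def mult.left_commute)
    next
      case (step y)
      then obtain t where t: "t \<in> \<O>" "y = monom t"
        by auto
      have "monom (Poly_Mapping.single j 1 + t) \<in> M"
      proof (cases "Poly_Mapping.single j 1 + t \<in> \<O>")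
        case True
        then show ?thesis
          using span_M by (auto simp: monomial_span_def intro: mpoly.span_base)
      next
        case False
        then show ?thesis
          using t by (intro border_M) (auto simp: border_def)
      qed
      then show ?case
        by (simp add: t monom_mult)
    qed
    ultimately show ?thesis
      using M g(3) by (simp add: distrib_left mpoly.subspace_add)
  qed
  have "monom m \<in> M" for m
  proof (induction m rule: monomial_induct)
    case (2 j m)
    then show ?case
      using shift[of "monom m" j] by (simp add: monom_mult)
  qed (rule one)
  then have "monomial_span UNIV \<subseteq> M"
    unfolding monomial_span_def using M by (intro mpoly.span_minimal) auto
  then have "M = UNIV"
    by (auto simp: monomial_span_eq)
  have "I \<subseteq> J"
  proof
    fix p assume "p \<in> I"
    have "p \<in> M"
      using \<open>M = UNIV\<close> by simp
    then obtain g r where g: "g \<in> J" "r \<in> monomial_span \<O>" "p = g + r"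
      unfolding M_def by blast
    have "p - g \<in> I"
      using \<open>p \<in> I\<close> g(1) \<open>J \<subseteq> I\<close> is_ideal_subspace[OF I] by (auto intro: mpoly.subspace_diff)
    then have "r = 0"
      using g sum by (auto simp: direct_sum_with_def)
    then show "p \<in> J"
      using g by simp
  qed
  moreover have "G = (\<lambda>b. monom b - (\<Sum>t\<in>\<O>. scale (Poly_Mapping.lookup (q b) t) (monom t))) ` border \<O>"
    unfolding G_def using q_sum by simp
  ultimately have "border_basis \<O> I G"
    using \<open>J \<subseteq> I\<close> sum unfolding border_basis_def J_def[symmetric]
    by (intro conjI exI[of _ "\<lambda>t b. Poly_Mapping.lookup (q b) t"]) auto
  then show ?thesis
    by (auto simp: supports_border_basis_def)
qed

section \<open>Integral points of the order ideal polytope\<close>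

lemma Lambda_iff:
  fixes I :: "('n::finite, 'k::field) mpoly set"
  assumes I: "is_ideal I"
  shows "\<O> \<in> Lambda I \<longleftrightarrow> order_ideal \<O> \<and>
    (\<forall>i. int (card {m \<in> \<O>. mdeg m = i}) = codim_graded_piece I i \<and>
      monomial_span {m \<in> \<O>. mdeg m = i} \<inter> graded_piece I i = {0})"
  using direct_sum_with_imp_graded_trivial[OF I] direct_sum_with_if_graded[OF I, of \<O>]
    supports_border_basis_if_direct_sum[OF I]
  by (auto simp: Lambda_def degree_compatible_def dim_monomial_span supports_border_basis_def border_basis_def)

theorem theorem3p2:
  fixes I :: "('n::finite, 'k::field) mpoly set"
  assumes "is_ideal I" and "zero_dimensional I"
  shows "bij_betw (\<lambda>z. {m. z m = 1})
           (order_ideal_polytope I \<inter> {z. \<forall>m. z m \<in> \<int>}) (Lambda I)"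
proof (rule bij_betw_imageI)
  let ?P = "order_ideal_polytope I \<inter> {z. \<forall>m. z m \<in> \<int>}"
  let ?d = "codim_graded_piece I"
  have indicator: "z m = (if z m = 1 then 1 else 0)" if "z \<in> ?P" for z m
  proof -
    have "0 \<le> z m" "z m \<le> 1" "z m \<in> \<int>"
      using that by (auto simp: order_ideal_polytope_def)
    then obtain k :: int where "z m = of_int k" "0 \<le> k" "k \<le> 1"
      by (auto elim!: Ints_cases)
    then show ?thesis
      by (cases "k = 0") auto
  qed
  have sum_indicator: "(\<Sum>m\<in>U. if m \<in> S then 1 else 0 :: real) = card (U \<inter> S)"
    if "finite U" for U S :: "'n monomial set"
    using that by (simp add: sum.If_cases)
  show "inj_on (\<lambda>z. {m. z m = 1}) ?P"
  proof (rule inj_onI)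
    fix y z assume yz: "y \<in> ?P" "z \<in> ?P" and eq: "{m. y m = 1} = {m. z m = 1}"
    show "y = z"
    proof
      fix m
      have "y m = 1 \<longleftrightarrow> z m = 1"
        using eq by blast
      then show "y m = z m"
        using indicator[OF yz(1), of m] indicator[OF yz(2), of m] by presburger
    qed
  qed
  have "{m. z m = 1} \<in> Lambda I" if z: "z \<in> ?P" for z
  proof -
    let ?O = "{m. z m = 1}"
    let ?U = "\<lambda>i. {m \<in> ?O. mdeg m = i}"
    have U: "?U i = monomials_of_deg i \<inter> ?O" for i
      by (auto simp: monomials_of_deg_def)
    have z_eq: "z = (\<lambda>m. if m \<in> ?O then 1 else 0)"
      using indicator[OF z] by auto
    have card: "int (card (?U i)) = ?d i" for i
    proof -
      have "real (card (?U i)) = (\<Sum>m\<in>monomials_of_deg i. z m)"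
        by (subst z_eq) (simp only: sum_indicator[OF finite_monomials_of_deg] U)
      also have "\<dots> = of_int (?d i)"
        using z by (simp add: order_ideal_polytope_def)
      finally show ?thesis
        by linarith
    qed
    have fin: "finite (?U i)" for i
      unfolding U using finite_monomials_of_deg by blast
    have rank: "(\<Sum>m\<in>V. z m) \<le> real (mpoly.dim (mpoly.span (monom ` V \<union> graded_piece I i)))
        - real (mpoly.dim (graded_piece I i))"
      if "V \<subseteq> monomials_of_deg i" "int (card V) = ?d i" for V i
      using z that by (simp add: order_ideal_polytope_def del: mpoly.dim_span)
    have trivial: "monomial_span (?U i) \<inter> graded_piece I i = {0}" for i
    proof -
      have "?U i \<subseteq> monomials_of_deg i"
        unfolding U by blast
      then have "(\<Sum>m\<in>?U i. z m) \<le> real (mpoly.dim (mpoly.span (monom ` ?U i \<union> graded_piece I i)))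
          - real (mpoly.dim (graded_piece I i))"
        using card by (rule rank)
      moreover have "(\<Sum>m\<in>?U i. z m) = card (?U i)"
        by simp
      ultimately show ?thesis
        unfolding dim_span_monoms_graded_piece_ge_iff[OF assms(1) fin, symmetric] by linarith
    qed
    obtain D where D: "\<And>i. i > D \<Longrightarrow> ?d i = 0"
      using zero_dimensional_codim_eventually_0[OF assms] by blast
    have "mdeg m \<le> D" if "m \<in> ?O" for m
    proof (rule ccontr)
      assume "\<not> mdeg m \<le> D"
      then have "?U (mdeg m) = {}"
        using card[of "mdeg m"] D[of "mdeg m"] fin[of "mdeg m"] by simp
      then show False
        using that by blast
    qed
    then have "?O \<subseteq> (\<Union>i\<le>D. ?U i)"
      by auto
    then have "finite ?O"
      by (rule finite_subset) (simp add: fin del: mem_Collect_eq)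
    moreover have "s \<in> ?O" if "t \<in> ?O" "mdvd s t" for s t
    proof -
      have "z t \<le> z s" "z s \<le> 1"
        using z that(2) by (auto simp: order_ideal_polytope_def)
      then show ?thesis
        using that(1) by auto
    qed
    ultimately show ?thesis
      unfolding Lambda_iff[OF assms(1)] order_ideal_def using card trivial by blast
  qed
  moreover have "\<exists>z\<in>?P. \<O> = {m. z m = 1}" if "\<O> \<in> Lambda I" for \<O>
  proof
    let ?z = "\<lambda>m. if m \<in> \<O> then 1 else 0 :: real"
    let ?U = "\<lambda>i. {m \<in> \<O>. mdeg m = i}"
    have O: "order_ideal \<O>" "\<And>i. int (card (?U i)) = ?d i"
      "\<And>i. monomial_span (?U i) \<inter> graded_piece I i = {0}"
      using that by (auto simp: Lambda_iff[OF assms(1)])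
    show "\<O> = {m. ?z m = 1}"
      by auto
    have "(\<Sum>m\<in>monomials_of_deg i. ?z m) = of_int (?d i)" for i
    proof -
      have "monomials_of_deg i \<inter> \<O> = ?U i"
        by (auto simp: monomials_of_deg_def)
      then have "(\<Sum>m\<in>monomials_of_deg i. ?z m) = card (?U i)"
        by (simp only: sum_indicator[OF finite_monomials_of_deg])
      then show ?thesis
        using O(2)[of i] by linarith
    qed
    moreover have "(\<Sum>m\<in>U. ?z m) \<le> real (mpoly.dim (mpoly.span (monom ` U \<union> graded_piece I i)))
        - real (mpoly.dim (graded_piece I i))" if "U \<subseteq> monomials_of_deg i" for i U
    proof -
      have fin: "finite U"
        using that finite_monomials_of_deg by (rule finite_subset)
      have "U \<inter> \<O> \<subseteq> ?U i"
        using that by (auto simp: monomials_of_deg_def)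
      then have "monomial_span (U \<inter> \<O>) \<subseteq> (monomial_span (?U i) :: ('n, 'k) mpoly set)"
        by (auto simp: monomial_span_eq)
      then have "monomial_span (U \<inter> \<O>) \<inter> graded_piece I i = {0}"
        using O(3)[of i] mpoly.subspace_0[OF subspace_graded_piece[OF assms(1)]]
        by (auto simp: monomial_span_eq)
      then have "card (U \<inter> \<O>) + mpoly.dim (graded_piece I i) \<le>
          mpoly.dim (mpoly.span (monom ` (U \<inter> \<O>) \<union> graded_piece I i))"
        using dim_span_monoms_graded_piece_ge_iff[OF assms(1)] fin by blast
      also have "\<dots> \<le> mpoly.dim (mpoly.span (monom ` U \<union> graded_piece I i))"
      proof (rule mpoly.dim_span_mono[of _ _ "monom ` monomials_of_deg i"])
        show "monom ` U \<union> graded_piece I i \<subseteq> mpoly.span (monom ` monomials_of_deg i)"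
          using that graded_piece_subset[of I i] by (auto simp: monomial_span_def intro: mpoly.span_base)
      qed (auto simp: finite_monomials_of_deg)
      finally show ?thesis
        by (simp only: sum_indicator[OF fin])
    qed
    ultimately show "?z \<in> ?P"
      using O(1) by (auto simp: order_ideal_polytope_def order_ideal_def)
  qed
  ultimately show "(\<lambda>z. {m. z m = 1}) ` ?P = Lambda I"
    by blast
qed

end
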